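(* Let $(A,\Omega)$ be an algebra of finitary type. There is a one-to-one correspondence between the set $\mathrm{Con}_{\mathrm{fi}}(\mathcal P_{>0}^{<\omega}A)$ of all fully invariant congruences of the algebra $(\mathcal P_{>0}^{<\omega}A,\Omega,\cup)$ and the set $\mathrm{Clo}_{\mathrm{fi}}(A)$.
   Context: $\mathcal P A$ is the set of all subsets of $A$, $\mathcal P_{>0}^{<\omega}A$ the set of all finite non-empty subsets of $A$. Each $n$-ary $\omega\in\Omega$ acts on subsets as a complex operation: $\omega(A_1,\dots,A_n)=\{\omega(a_1,\dots,a_n)\mid a_i\in A_i\}$. Thus $(\mathcal P_{>0}^{<\omega}A,\Omega,\cup)$ is an algebra with the complex operations $\Omega$ and binary union. A congruence is fully invariant if it is preserved by all endomorphisms of the algebra. A closure operator $\mathcal C:\mathcal P A\to\mathcal P A$ on $A$ (extensive, monotone, idempotent) is algebraic if $\mathcal C(B)=\bigcup\{\mathcal C(F)\mid F\in\mathcal P_{>0}^{<\omega}B\}$ for all $B\subseteq A$, and $\varnothing$-preserving if $\mathcal C(\varnothing)=\varnothing$. $\mathrm{Clo}_{\mathrm{fi}}(A)$ is the set of all algebraic $\varnothing$-preserving closure operators $\mathcal C$ on $A$ such that (1) for every $n$-ary $\omega\in\Omega$ with $n>0$ and all $T_1,\dots,T_n\in\mathcal P_{>0}^{<\omega}A$: $\omega(\mathcal C(T_1),\dots,\mathcal C(T_n))\subseteq\mathcal C(\omega(T_1,\dots,T_n))$; (2) for every endomorphism $\varphi$ of $(\mathcal P_{>0}^{<\omega}A,\Omega,\cup)$,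 every $T\in\mathcal P_{>0}^{<\omega}A$ and every $r\in\mathcal C(T)$: $\varphi(\{r\})\subseteq\mathcal C(\varphi(T))$. *)

theory Defs
  imports "HOL-Library.FuncSet"
begin

text \<open>
  An algebra of finitary type is given by a carrier \<open>A\<close>, a set \<open>\<Omega>\<close> of operation symbols, an arity
  function \<open>ar\<close> and an interpretation \<open>op\<close>. The value \<open>op f xs\<close> is relevant only if \<open>f \<in> \<Omega>\<close>, the
  entries of \<open>xs\<close> lie in \<open>A\<close>, and \<open>length xs = ar f\<close>. Nullary symbols are allowed, and \<open>A\<close> may be
  empty if there are none.
\<close>

definition universal_algebra ::
  "'a set \<Rightarrow> 'f set \<Rightarrow> ('f \<Rightarrow> nat) \<Rightarrow> ('f \<Rightarrow> 'a list \<Rightarrow> 'a) \<Rightarrow> bool" where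
  "universal_algebra A \<Omega> ar op \<longleftrightarrow>
     (\<forall>f\<in>\<Omega>. \<forall>xs\<in>lists A. length xs = ar f \<longrightarrow> op f xs \<in> A)"

definition endomorphisms ::
  "'a set \<Rightarrow> 'f set \<Rightarrow> ('f \<Rightarrow> nat) \<Rightarrow> ('f \<Rightarrow> 'a list \<Rightarrow> 'a) \<Rightarrow> ('a \<Rightarrow> 'a) set" where
  "endomorphisms A \<Omega> ar op =
     {\<phi> \<in> A \<rightarrow>\<^sub>E A. \<forall>f\<in>\<Omega>. \<forall>xs\<in>lists A. length xs = ar f \<longrightarrow>
        \<phi> (op f xs) = op f (map \<phi> xs)}"

definition congruences ::
  "'a set \<Rightarrow> 'f set \<Rightarrow> ('f \<Rightarrow> nat) \<Rightarrow> ('f \<Rightarrow> 'a list \<Rightarrow> 'a) \<Rightarrow> ('a \<times> 'a) set set" where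
  "congruences A \<Omega> ar op =
     {\<Theta>. equiv A \<Theta> \<and>
        (\<forall>f\<in>\<Omega>. \<forall>xs ys. length xs = ar f \<and> list_all2 (\<lambda>x y. (x, y) \<in> \<Theta>) xs ys \<longrightarrow>
           (op f xs, op f ys) \<in> \<Theta>)}"

definition fully_invariant_congruences ::
  "'a set \<Rightarrow> 'f set \<Rightarrow> ('f \<Rightarrow> nat) \<Rightarrow> ('f \<Rightarrow> 'a list \<Rightarrow> 'a) \<Rightarrow> ('a \<times> 'a) set set" where
  "fully_invariant_congruences A \<Omega> ar op =
     {\<Theta> \<in> congruences A \<Omega> ar op.
        \<forall>\<phi>\<in>endomorphisms A \<Omega> ar op. \<forall>(x, y)\<in>\<Theta>. (\<phi> x, \<phi> y) \<in> \<Theta>}"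

definition finite_nonempty_subsets :: "'a set \<Rightarrow> 'a set set" where
  "finite_nonempty_subsets A = {T. T \<subseteq> A \<and> finite T \<and> T \<noteq> {}}"

definition complex_op :: "('a list \<Rightarrow> 'a) \<Rightarrow> 'a set list \<Rightarrow> 'a set" where
  "complex_op g As = {g as | as. list_all2 (\<in>) as As}"

text \<open>
  The algebra of finite nonempty subsets has one binary symbol in addition to \<open>\<Omega>\<close>, interpreted as
  union.
\<close>

datatype 'f union_symbol = Op 'f | Union_Op

definition union_signature :: "'f set \<Rightarrow> 'f union_symbol set" where
  "union_signature \<Omega> = insert Union_Op (Op ` \<Omega>)"

fun union_arity :: "('f \<Rightarrow> nat) \<Rightarrow> 'f union_symbol \<Rightarrow> nat" where
  "union_arity ar (Op f) = ar f"
| "union_arity ar Union_Op = 2"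

fun union_interp :: "('f \<Rightarrow> 'a list \<Rightarrow> 'a) \<Rightarrow> 'f union_symbol \<Rightarrow> 'a set list \<Rightarrow> 'a set" where
  "union_interp op (Op f) Ts = complex_op (op f) Ts"
| "union_interp op Union_Op Ts = Ts ! 0 \<union> Ts ! 1"

lemma set_subset_Union_if_list_all2_mem:
  "list_all2 (\<in>) as As \<Longrightarrow> set as \<subseteq> \<Union> (set As)"
  by (induction rule: list_all2_induct) auto

lemma complex_op_mem_finite_nonempty_subsets:
  assumes "universal_algebra A \<Omega> ar op" "f \<in> \<Omega>"
    and Ts: "Ts \<in> lists (finite_nonempty_subsets A)" "length Ts = ar f"
  shows "complex_op (op f) Ts \<in> finite_nonempty_subsets A"
proof -
  let ?S = "{as. list_all2 (\<in>) as Ts}"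
  have eq: "complex_op (op f) Ts = op f ` ?S"
    unfolding complex_op_def by blast
  have "\<Union> (set Ts) \<subseteq> A" "finite (\<Union> (set Ts))"
    using Ts by (auto simp: finite_nonempty_subsets_def)
  moreover have S: "?S \<subseteq> {as. set as \<subseteq> \<Union> (set Ts) \<and> length as = length Ts}"
    using set_subset_Union_if_list_all2_mem list_all2_lengthD by blast
  ultimately have "finite ?S" and "?S \<subseteq> {as \<in> lists A. length as = ar f}"
    using finite_subset[OF S] finite_lists_length_eq Ts(2) by (blast, fastforce)
  moreover have "op f as \<in> A" if "as \<in> lists A" "length as = ar f" for as
    using assms that unfolding universal_algebra_def by blast
  moreover have "list_all2 (\<in>) (map (\<lambda>T. SOME x. x \<in> T) Ts) Ts"
    using Ts(1) by (induction Ts) (auto simp: finite_nonempty_subsets_def some_in_eq)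
  ultimately show ?thesis
    unfolding eq finite_nonempty_subsets_def by blast
qed

lemma universal_algebra_finite_nonempty_subsets:
  assumes "universal_algebra A \<Omega> ar op"
  shows "universal_algebra (finite_nonempty_subsets A) (union_signature \<Omega>) (union_arity ar)
           (union_interp op)"
proof -
  have "Ts ! 0 \<union> Ts ! 1 \<in> finite_nonempty_subsets A"
    if "Ts \<in> lists (finite_nonempty_subsets A)" "length Ts = 2" for Ts
  proof -
    have "Ts ! 0 \<in> finite_nonempty_subsets A" "Ts ! 1 \<in> finite_nonempty_subsets A"
      using that by (auto intro: nth_mem)
    then show ?thesis
      by (auto simp: finite_nonempty_subsets_def)
  qed
  then show ?thesis
    using complex_op_mem_finite_nonempty_subsets[OF assms]
    unfolding universal_algebra_def union_signature_def by simp
qed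

definition power_endomorphisms ::
  "'a set \<Rightarrow> 'f set \<Rightarrow> ('f \<Rightarrow> nat) \<Rightarrow> ('f \<Rightarrow> 'a list \<Rightarrow> 'a) \<Rightarrow> ('a set \<Rightarrow> 'a set) set" where
  "power_endomorphisms A \<Omega> ar op =
     endomorphisms (finite_nonempty_subsets A) (union_signature \<Omega>) (union_arity ar)
       (union_interp op)"

definition Con_fi ::
  "'a set \<Rightarrow> 'f set \<Rightarrow> ('f \<Rightarrow> nat) \<Rightarrow> ('f \<Rightarrow> 'a list \<Rightarrow> 'a) \<Rightarrow> ('a set \<times> 'a set) set set" where
  "Con_fi A \<Omega> ar op =
     fully_invariant_congruences (finite_nonempty_subsets A) (union_signature \<Omega>) (union_arity ar)
       (union_interp op)"

text \<open>
  Operators are taken to be \<open>undefined\<close> outside \<open>Pow A\<close>, so that equality of functions is equality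
  of maps \<open>Pow A \<rightarrow> Pow A\<close>.
\<close>

definition closure_operator_on :: "'a set \<Rightarrow> ('a set \<Rightarrow> 'a set) \<Rightarrow> bool" where
  "closure_operator_on A C \<longleftrightarrow>
     C \<in> Pow A \<rightarrow>\<^sub>E Pow A \<and>
     (\<forall>B\<in>Pow A. B \<subseteq> C B) \<and>
     mono_on (Pow A) C \<and>
     (\<forall>B\<in>Pow A. C (C B) = C B)"

definition algebraic_on :: "'a set \<Rightarrow> ('a set \<Rightarrow> 'a set) \<Rightarrow> bool" where
  "algebraic_on A C \<longleftrightarrow> (\<forall>B\<in>Pow A. C B = \<Union> (C ` finite_nonempty_subsets B))"

definition Clo_fi ::
  "'a set \<Rightarrow> 'f set \<Rightarrow> ('f \<Rightarrow> nat) \<Rightarrow> ('f \<Rightarrow> 'a list \<Rightarrow> 'a) \<Rightarrow> ('a set \<Rightarrow> 'a set) set" where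
  "Clo_fi A \<Omega> ar op =
     {C. closure_operator_on A C \<and> algebraic_on A C \<and> C {} = {} \<and>
        (\<forall>f\<in>\<Omega>. ar f > 0 \<longrightarrow>
           (\<forall>Ts\<in>lists (finite_nonempty_subsets A). length Ts = ar f \<longrightarrow>
              complex_op (op f) (map C Ts) \<subseteq> C (complex_op (op f) Ts))) \<and>
        (\<forall>\<phi>\<in>power_endomorphisms A \<Omega> ar op. \<forall>T\<in>finite_nonempty_subsets A. \<forall>r\<in>C T.
           \<phi> {r} \<subseteq> C (\<phi> T))}"

end

theory Submission
  imports Defs
begin

text \<open>
  A congruence \<open>\<Theta>\<close> of a join semilattice is determined by the preorder \<open>(S \<union> T, T) \<in> \<Theta>\<close>. On finite
  nonempty sets this preorder is determined by its instances with a singleton \<open>S\<close>, that is, by the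
  map sending \<open>T\<close> to the set of all \<open>a\<close> with \<open>(insert a T, T) \<in> \<Theta>\<close>. These sets are the closed sets
  generated by \<open>T\<close>; in the opposite direction, two sets are congruent if they have the same closure.
\<close>

definition closure_of_congruence :: "'a set \<Rightarrow> ('a set \<times> 'a set) set \<Rightarrow> 'a set \<Rightarrow> 'a set" where
  "closure_of_congruence A \<Theta> =
     (\<lambda>B\<in>Pow A. {a \<in> A. \<exists>T\<in>finite_nonempty_subsets B. (insert a T, T) \<in> \<Theta>})"

definition congruence_of_closure :: "'a set \<Rightarrow> ('a set \<Rightarrow> 'a set) \<Rightarrow> ('a set \<times> 'a set) set" where
  "congruence_of_closure A C =
     {(S, T). S \<in> finite_nonempty_subsets A \<and> T \<in> finite_nonempty_subsets A \<and> C S = C T}"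

section \<open>Finite nonempty subsets, complex operations and endomorphisms of the power
  algebra\<close>

lemma finite_nonempty_subsets_mono:
  "A \<subseteq> B \<Longrightarrow> finite_nonempty_subsets A \<subseteq> finite_nonempty_subsets B"
  unfolding finite_nonempty_subsets_def by blast

lemma finite_nonempty_subsets_Un:
  "S \<in> finite_nonempty_subsets A \<Longrightarrow> T \<in> finite_nonempty_subsets A \<Longrightarrow>
     S \<union> T \<in> finite_nonempty_subsets A"
  unfolding finite_nonempty_subsets_def by blast

lemma finite_nonempty_subsets_insert:
  "a \<in> A \<Longrightarrow> T \<in> finite_nonempty_subsets A \<Longrightarrow> insert a T \<in> finite_nonempty_subsets A"
  unfolding finite_nonempty_subsets_def by blast

lemma singleton_mem_finite_nonempty_subsets: "a \<in> A \<Longrightarrow> {a} \<in> finite_nonempty_subsets A"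
  unfolding finite_nonempty_subsets_def by blast

lemma complex_op_mono:
  assumes "list_all2 (\<subseteq>) Ss Ts"
  shows "complex_op g Ss \<subseteq> complex_op g Ts"
proof -
  have "list_all2 (\<in>) as Ts" if "list_all2 (\<in>) as Ss" for as
    using list_all2_trans[OF _ that assms] by blast
  then show ?thesis
    unfolding complex_op_def by blast
qed

lemma power_endomorphisms_mem:
  assumes "\<phi> \<in> power_endomorphisms A \<Omega> ar op" "T \<in> finite_nonempty_subsets A"
  shows "\<phi> T \<in> finite_nonempty_subsets A"
  using assms unfolding power_endomorphisms_def endomorphisms_def by blast

lemma power_endomorphisms_Un:
  assumes "\<phi> \<in> power_endomorphisms A \<Omega> ar op"
    and "S \<in> finite_nonempty_subsets A" "T \<in> finite_nonempty_subsets A"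
  shows "\<phi> (S \<union> T) = \<phi> S \<union> \<phi> T"
proof -
  have "\<forall>xs\<in>lists (finite_nonempty_subsets A). length xs = 2 \<longrightarrow>
      \<phi> (union_interp op Union_Op xs) = union_interp op Union_Op (map \<phi> xs)"
    using assms(1) unfolding power_endomorphisms_def endomorphisms_def union_signature_def by simp
  from bspec[OF this, of "[S, T]"] show ?thesis
    using assms(2,3) by simp
qed

text \<open>Endomorphisms preserve binary unions, and a finite nonempty set is built from singletons
  by such unions. The invariance condition in \<open>Clo_fi\<close> speaks only of the sets
  \<open>\<phi> {r}\<close>; this lemma passes from them to \<open>\<phi> T\<close>.\<close>

lemma power_endomorphisms_UN_singletons:
  assumes \<phi>: "\<phi> \<in> power_endomorphisms A \<Omega> ar op"
    and T: "T \<in> finite_nonempty_subsets A"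
  shows "\<phi> T = (\<Union>t\<in>T. \<phi> {t})"
proof -
  have "finite T" "T \<noteq> {}" "T \<subseteq> A"
    using T unfolding finite_nonempty_subsets_def by blast+
  then show ?thesis
  proof (induction rule: finite_ne_induct)
    case (insert x F)
    then have "\<phi> ({x} \<union> F) = \<phi> {x} \<union> \<phi> F"
      by (intro power_endomorphisms_Un[OF \<phi>]) (auto simp: finite_nonempty_subsets_def)
    with insert show ?case by simp
  qed simp
qed

section \<open>Membership in the two sets of the correspondence\<close>

text \<open>Compatibility over \<open>union_signature\<close> splits into a clause for the symbols
  in \<open>\<Omega>\<close> and one for union. The latter is restated for pairs instead of lists of
  length 2, which is the form assumed by the locale \<open>semilattice_congruence\<close>.\<close>

lemma Con_fi_iff:
  "\<Theta> \<in> Con_fi A \<Omega> ar op \<longleftrightarrow>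
     equiv (finite_nonempty_subsets A) \<Theta> \<and>
     (\<forall>f\<in>\<Omega>. \<forall>Ss Ts. length Ss = ar f \<and> list_all2 (\<lambda>S T. (S, T) \<in> \<Theta>) Ss Ts \<longrightarrow>
        (complex_op (op f) Ss, complex_op (op f) Ts) \<in> \<Theta>) \<and>
     (\<forall>S S' T T'. (S, S') \<in> \<Theta> \<and> (T, T') \<in> \<Theta> \<longrightarrow> (S \<union> T, S' \<union> T') \<in> \<Theta>) \<and>
     (\<forall>\<phi>\<in>power_endomorphisms A \<Omega> ar op. \<forall>(S, T)\<in>\<Theta>. (\<phi> S, \<phi> T) \<in> \<Theta>)"
proof -
  have Union_Op_iff: "(\<forall>xs ys. length xs = 2 \<and> list_all2 (\<lambda>x y. (x, y) \<in> \<Theta>) xs ys \<longrightarrow>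
        (xs ! 0 \<union> xs ! 1, ys ! 0 \<union> ys ! 1) \<in> \<Theta>) \<longleftrightarrow>
      (\<forall>S S' T T'. (S, S') \<in> \<Theta> \<and> (T, T') \<in> \<Theta> \<longrightarrow> (S \<union> T, S' \<union> T') \<in> \<Theta>)"
    (is "?L \<longleftrightarrow> ?R")
  proof
    assume L: ?L
    show ?R
    proof (intro allI impI)
      fix S S' T T' assume "(S, S') \<in> \<Theta> \<and> (T, T') \<in> \<Theta>"
      with L[rule_format, of "[S, T]" "[S', T']"] show "(S \<union> T, S' \<union> T') \<in> \<Theta>"
        by simp
    qed
  next
    assume R: ?R
    show ?L
    proof (intro allI impI)
      fix xs ys assume xs: "length xs = 2 \<and> list_all2 (\<lambda>x y. (x, y) \<in> \<Theta>) xs ys"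
      then have "(xs ! 0, ys ! 0) \<in> \<Theta>" "(xs ! 1, ys ! 1) \<in> \<Theta>"
        by (simp_all add: list_all2_conv_all_nth)
      with R show "(xs ! 0 \<union> xs ! 1, ys ! 0 \<union> ys ! 1) \<in> \<Theta>"
        by blast
    qed
  qed
  show ?thesis
    unfolding Con_fi_def fully_invariant_congruences_def congruences_def union_signature_def
      power_endomorphisms_def mem_Collect_eq ball_simps union_arity.simps union_interp.simps
      Union_Op_iff
    by (rule iffI; elim conjE; intro conjI; assumption)
qed

lemma Clo_fi_iff:
  "C \<in> Clo_fi A \<Omega> ar op \<longleftrightarrow>
     closure_operator_on A C \<and> algebraic_on A C \<and> C {} = {} \<and>
     (\<forall>f\<in>\<Omega>. ar f > 0 \<longrightarrow>
        (\<forall>Ts\<in>lists (finite_nonempty_subsets A). length Ts = ar f \<longrightarrow>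
           complex_op (op f) (map C Ts) \<subseteq> C (complex_op (op f) Ts))) \<and>
     (\<forall>\<phi>\<in>power_endomorphisms A \<Omega> ar op. \<forall>T\<in>finite_nonempty_subsets A. \<forall>r\<in>C T.
        \<phi> {r} \<subseteq> C (\<phi> T))"
  unfolding Clo_fi_def by (rule mem_Collect_eq)

section \<open>Closure operators on a carrier\<close>

locale closure_operator =
  fixes A :: "'a set" and C :: "'a set \<Rightarrow> 'a set"
  assumes closure_operator_on: "closure_operator_on A C"
begin

lemma closure_subset_carrier: "B \<subseteq> A \<Longrightarrow> C B \<subseteq> A"
  using closure_operator_on unfolding closure_operator_on_def by blast

lemma subset_closure: "B \<subseteq> A \<Longrightarrow> B \<subseteq> C B"
  using closure_operator_on unfolding closure_operator_on_def by blast

lemma closure_subset_iff: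
  assumes "B \<subseteq> A" "D \<subseteq> A"
  shows "C B \<subseteq> C D \<longleftrightarrow> B \<subseteq> C D"
proof
  assume "B \<subseteq> C D"
  with assms have "C B \<subseteq> C (C D)"
    using closure_operator_on closure_subset_carrier[OF assms(2)]
    unfolding closure_operator_on_def by (meson PowI mono_onD)
  then show "C B \<subseteq> C D"
    using closure_operator_on assms unfolding closure_operator_on_def by simp
qed (use subset_closure assms in blast)

text \<open>This recovers a closure operator from its congruence: for finite nonempty
  \<open>B\<close>, the left side says that \<open>insert a B\<close> and \<open>B\<close> are
  congruent.\<close>

lemma closure_insert_eq_iff:
  assumes "a \<in> A" "B \<subseteq> A"
  shows "C (insert a B) = C B \<longleftrightarrow> a \<in> C B"
  using assms closure_subset_iff[of "insert a B" B] closure_subset_iff[of B "insert a B"]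
    subset_closure[of "insert a B"] subset_closure[of B]
  by blast

end

section \<open>The closure operator of a semilattice congruence\<close>

locale semilattice_congruence =
  fixes A :: "'a set" and \<Theta> :: "('a set \<times> 'a set) set"
  assumes equiv: "equiv (finite_nonempty_subsets A) \<Theta>"
    and Un_cong: "(S, S') \<in> \<Theta> \<Longrightarrow> (T, T') \<in> \<Theta> \<Longrightarrow> (S \<union> T, S' \<union> T') \<in> \<Theta>"
begin

abbreviation closure :: "'a set \<Rightarrow> 'a set" where
  "closure \<equiv> closure_of_congruence A \<Theta>"

lemma cong_refl: "T \<in> finite_nonempty_subsets A \<Longrightarrow> (T, T) \<in> \<Theta>"
  using equiv by (meson equivE refl_onD)

lemma cong_sym: "(S, T) \<in> \<Theta> \<Longrightarrow> (T, S) \<in> \<Theta>"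
  using equiv by (meson equivE symD)

lemma cong_trans: "(S, T) \<in> \<Theta> \<Longrightarrow> (T, U) \<in> \<Theta> \<Longrightarrow> (S, U) \<in> \<Theta>"
  using equiv by (meson equivE transD)

lemma cong_mem:
  assumes "(S, T) \<in> \<Theta>"
  shows "S \<in> finite_nonempty_subsets A" "T \<in> finite_nonempty_subsets A"
  using equiv_type[OF equiv] assms by blast+

text \<open>Joining \<open>R\<close> to both sides of \<open>(T, S)\<close> gives
  \<open>(R \<union> T, S)\<close>, since \<open>R\<close> is absorbed by \<open>S\<close>; then
  \<open>S\<close> is replaced by \<open>T\<close>. In terms of the preorder: whatever lies below
  \<open>S\<close> lies below every set congruent to \<open>S\<close>.\<close>

lemma cong_Un_right_if_subset:
  assumes ST: "(S, T) \<in> \<Theta>" and R: "R \<subseteq> S" "R \<noteq> {}"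
  shows "(R \<union> T, T) \<in> \<Theta>"
proof -
  have "(R, R) \<in> \<Theta>"
    using cong_mem(1)[OF ST] R
    by (intro cong_refl) (auto simp: finite_nonempty_subsets_def intro: finite_subset)
  from Un_cong[OF this cong_sym[OF ST]] have "(R \<union> T, S) \<in> \<Theta>"
    using R by (simp add: Un_absorb1)
  then show ?thesis
    using ST cong_trans by blast
qed

lemma mem_closure_iff:
  assumes "B \<subseteq> A"
  shows "a \<in> closure B \<longleftrightarrow>
    a \<in> A \<and> (\<exists>T\<in>finite_nonempty_subsets B. (insert a T, T) \<in> \<Theta>)"
  using assms unfolding closure_of_congruence_def by simp

text \<open>A finite \<open>T\<close> can serve as its own witness: a pair
  \<open>(insert a S, S)\<close> with \<open>S \<subseteq> T\<close> becomes
  \<open>(insert a T, T)\<close> after joining \<open>T\<close> to both sides.\<close>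

lemma mem_closure_finite_iff:
  assumes T: "T \<in> finite_nonempty_subsets A"
  shows "a \<in> closure T \<longleftrightarrow> (insert a T, T) \<in> \<Theta>"
proof
  have TA: "T \<subseteq> A" using T unfolding finite_nonempty_subsets_def by blast
  {
    assume "a \<in> closure T"
    then obtain S where S: "S \<subseteq> T" "(insert a S, S) \<in> \<Theta>"
      unfolding mem_closure_iff[OF TA] finite_nonempty_subsets_def by blast
    from Un_cong[OF S(2) cong_refl[OF T]] show "(insert a T, T) \<in> \<Theta>"
      using S(1) by (simp add: Un_absorb1)
  next
    assume "(insert a T, T) \<in> \<Theta>"
    moreover from cong_mem(1)[OF this] have "a \<in> A"
      unfolding finite_nonempty_subsets_def by blast
    moreover have "T \<in> finite_nonempty_subsets T"
      using T unfolding finite_nonempty_subsets_def by blast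
    ultimately show "a \<in> closure T"
      unfolding mem_closure_iff[OF TA] by blast
  }
qed

text \<open>The preorder is determined by singletons: the finitely many pairs
  \<open>(insert a T, T)\<close> with \<open>a \<in> S\<close> are joined into one, and conversely
  each of them is cut out of \<open>(S \<union> T, T)\<close>.\<close>

lemma subset_closure_finite_iff:
  assumes S: "S \<in> finite_nonempty_subsets A" and T: "T \<in> finite_nonempty_subsets A"
  shows "S \<subseteq> closure T \<longleftrightarrow> (S \<union> T, T) \<in> \<Theta>"
proof
  assume ST: "(S \<union> T, T) \<in> \<Theta>"
  have "({a} \<union> T, T) \<in> \<Theta>" if "a \<in> S" for a
    using that by (intro cong_Un_right_if_subset[OF ST]) auto
  then show "S \<subseteq> closure T"
    using mem_closure_finite_iff[OF T] by auto
next
  assume sub: "S \<subseteq> closure T"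
  have "finite S" "S \<noteq> {}"
    using S unfolding finite_nonempty_subsets_def by blast+
  then show "(S \<union> T, T) \<in> \<Theta>"
    using sub
  proof (induction rule: finite_ne_induct)
    case (singleton x)
    then show ?case using mem_closure_finite_iff[OF T] by simp
  next
    case (insert x F)
    then have "(insert x T, T) \<in> \<Theta>" "(F \<union> T, T) \<in> \<Theta>"
      using mem_closure_finite_iff[OF T] by auto
    from Un_cong[OF this] show ?case by (simp add: Un_ac)
  qed
qed

lemma closure_mono:
  assumes "B \<subseteq> D" "D \<subseteq> A"
  shows "closure B \<subseteq> closure D"
  using assms mem_closure_iff[of B] mem_closure_iff[of D] finite_nonempty_subsets_mono[of B D]
  by blast

lemma closure_eq_UN_finite:
  assumes B: "B \<subseteq> A"
  shows "closure B = \<Union> (closure ` finite_nonempty_subsets B)"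
proof -
  have "a \<in> closure B \<longleftrightarrow> (\<exists>T\<in>finite_nonempty_subsets B. a \<in> closure T)" for a
  proof -
    have "a \<in> closure T \<longleftrightarrow> a \<in> A \<and> (insert a T, T) \<in> \<Theta>"
      if "T \<in> finite_nonempty_subsets B" for T
    proof -
      have T: "T \<in> finite_nonempty_subsets A"
        using that finite_nonempty_subsets_mono[OF B] by blast
      moreover have "a \<in> A" if "(insert a T, T) \<in> \<Theta>"
        using cong_mem(1)[OF that] unfolding finite_nonempty_subsets_def by blast
      ultimately show ?thesis
        using mem_closure_finite_iff[OF T] by blast
    qed
    then show ?thesis
      using mem_closure_iff[OF B] by auto
  qed
  then show ?thesis by blast
qed

text \<open>Each element of \<open>F\<close> has a finite witness in \<open>B\<close>; by
  monotonicity the union of these witnesses serves all elements at once. This is the finiteness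
  behind idempotence.\<close>

lemma finite_subset_closure:
  assumes B: "B \<subseteq> A" and F: "finite F" "F \<noteq> {}" "F \<subseteq> closure B"
  shows "\<exists>T\<in>finite_nonempty_subsets B. F \<subseteq> closure T"
  using F
proof (induction rule: finite_ne_induct)
  case (singleton x)
  then show ?case using closure_eq_UN_finite[OF B] by auto
next
  case (insert x F)
  then obtain S T where ST: "S \<in> finite_nonempty_subsets B" "T \<in> finite_nonempty_subsets B"
    "x \<in> closure S" "F \<subseteq> closure T"
    using closure_eq_UN_finite[OF B] by auto
  then have "S \<union> T \<subseteq> A"
    using B unfolding finite_nonempty_subsets_def by blast
  then have "closure S \<subseteq> closure (S \<union> T)" "closure T \<subseteq> closure (S \<union> T)"
    using closure_mono[OF Un_upper1] closure_mono[OF Un_upper2] by blast+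
  then have "insert x F \<subseteq> closure (S \<union> T)"
    using ST(3,4) by blast
  then show ?case
    using finite_nonempty_subsets_Un ST(1,2) by blast
qed

lemma closure_operator_on_closure: "closure_operator_on A closure"
proof -
  have sub: "closure B \<subseteq> A" if "B \<subseteq> A" for B
    using mem_closure_iff[OF that] by blast
  have ext: "B \<subseteq> closure B" if "B \<subseteq> A" for B
  proof
    fix a assume "a \<in> B"
    \<comment> \<open>The witness is \<open>{a}\<close>: since \<open>insert a {a} = {a}\<close>,
      reflexivity suffices.\<close>
    then have "{a} \<in> finite_nonempty_subsets B" "a \<in> A"
      using that unfolding finite_nonempty_subsets_def by auto
    then show "a \<in> closure B"
      unfolding mem_closure_iff[OF that]
      using cong_refl[OF singleton_mem_finite_nonempty_subsets, of a] by force
  qed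
  \<comment> \<open>Idempotence: the witness \<open>F\<close> for \<open>a\<close> lies in the
    closure of one finite \<open>T \<subseteq> B\<close>, so \<open>F \<union> T\<close> is
    congruent to \<open>T\<close>. Joining \<open>T\<close> to \<open>(insert a F, F)\<close> and
    using transitivity puts \<open>a\<close> below \<open>T\<close>.\<close>
  have "closure (closure B) \<subseteq> closure B" if B: "B \<subseteq> A" for B
  proof
    fix a assume "a \<in> closure (closure B)"
    then obtain F where a: "a \<in> A" and F: "F \<in> finite_nonempty_subsets (closure B)"
      and aF: "(insert a F, F) \<in> \<Theta>"
      unfolding mem_closure_iff[OF sub[OF B]] by blast
    obtain T where T: "T \<in> finite_nonempty_subsets B" "F \<subseteq> closure T"
      using finite_subset_closure[OF B, of F] F unfolding finite_nonempty_subsets_def by blast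
    have TA: "T \<in> finite_nonempty_subsets A"
      using T(1) finite_nonempty_subsets_mono[OF B] by blast
    have FT: "(F \<union> T, T) \<in> \<Theta>"
      using T(2) subset_closure_finite_iff[OF cong_mem(2)[OF aF] TA] by blast
    have "(insert a F \<union> T, F \<union> T) \<in> \<Theta>"
      using Un_cong[OF aF cong_refl[OF TA]] .
    then have "(insert a F \<union> T, T) \<in> \<Theta>"
      using FT cong_trans by blast
    then have "({a} \<union> T, T) \<in> \<Theta>"
      by (rule cong_Un_right_if_subset) auto
    then show "a \<in> closure B"
      using a T(1) mem_closure_iff[OF B] by auto
  qed
  then have "closure (closure B) = closure B" if "B \<subseteq> A" for B
    using ext[OF sub[OF that]] that by blast
  moreover have "closure \<in> extensional (Pow A)"
    unfolding closure_of_congruence_def by simp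
  ultimately show ?thesis
    unfolding closure_operator_on_def PiE_def Pi_def mono_on_def
    using sub ext closure_mono by simp
qed

lemma congruence_of_closure_closure: "congruence_of_closure A closure = \<Theta>"
proof -
  interpret closure_operator A closure
    by unfold_locales (rule closure_operator_on_closure)
  have carrier: "T \<subseteq> A" if "T \<in> finite_nonempty_subsets A" for T
    using that unfolding finite_nonempty_subsets_def by blast
  \<comment> \<open>The preorder becomes inclusion of closures. Equal closures then mean that
    \<open>S\<close> and \<open>T\<close> are both congruent to \<open>S \<union> T\<close>.\<close>
  have *: "closure S \<subseteq> closure T \<longleftrightarrow> (S \<union> T, T) \<in> \<Theta>"
    if "S \<in> finite_nonempty_subsets A" "T \<in> finite_nonempty_subsets A" for S T
    using that closure_subset_iff carrier subset_closure_finite_iff by simp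
  have "closure S = closure T \<longleftrightarrow> (S, T) \<in> \<Theta>"
    if "S \<in> finite_nonempty_subsets A" "T \<in> finite_nonempty_subsets A" for S T
  proof
    assume "closure S = closure T"
    then have "(S \<union> T, T) \<in> \<Theta>" "(T \<union> S, S) \<in> \<Theta>"
      using *[OF that] *[OF that(2,1)] by auto
    then show "(S, T) \<in> \<Theta>"
      using cong_sym cong_trans by (metis Un_commute)
  next
    assume ST: "(S, T) \<in> \<Theta>"
    have "(S \<union> T, T) \<in> \<Theta>" "(T \<union> S, S) \<in> \<Theta>"
      using that cong_Un_right_if_subset[OF ST] cong_Un_right_if_subset[OF cong_sym[OF ST]]
      unfolding finite_nonempty_subsets_def by auto
    then show "closure S = closure T"
      using *[OF that] *[OF that(2,1)] by blast
  qed
  then show ?thesis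
    unfolding congruence_of_closure_def using cong_mem by blast
qed

end

section \<open>From fully invariant congruences to closure operators\<close>

lemma closure_of_congruence_in_Clo_fi:
  assumes \<Theta>: "\<Theta> \<in> Con_fi A \<Omega> ar op"
  shows "closure_of_congruence A \<Theta> \<in> Clo_fi A \<Omega> ar op"
proof -
  interpret semilattice_congruence A \<Theta>
    using \<Theta> unfolding Con_fi_iff by unfold_locales blast+
  \<comment> \<open>Every element of a set congruent to \<open>T\<close> lies in the closure of
    \<open>T\<close>. Both conditions of \<open>Clo_fi\<close> are reduced to this by exhibiting a
    suitable congruent set.\<close>
  have mem_if: "a \<in> closure T" if ST: "(S, T) \<in> \<Theta>" and "a \<in> S" for a S T
    using cong_Un_right_if_subset[OF ST, of "{a}"] that
    by (simp add: mem_closure_finite_iff[OF cong_mem(2)[OF ST]])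
  have ops: "complex_op (op f) (map closure Ts) \<subseteq> closure (complex_op (op f) Ts)"
    if f: "f \<in> \<Omega>" and Ts: "Ts \<in> lists (finite_nonempty_subsets A)" "length Ts = ar f" for f Ts
  proof
    fix x assume "x \<in> complex_op (op f) (map closure Ts)"
    then obtain as where x: "x = op f as" and as: "list_all2 (\<in>) as (map closure Ts)"
      unfolding complex_op_def by blast
    have len: "length as = length Ts"
      using as by (auto dest: list_all2_lengthD)
    \<comment> \<open>The closures of the arguments may be infinite and hence lie outside the
      algebra. Adding to each argument only the chosen element of its closure keeps it finite and
      congruent to the original, while \<open>x\<close> becomes a value of \<open>op f\<close> on
      the enlarged arguments.\<close>
    let ?Ss = "map2 insert as Ts"
    have "(insert (as ! i) (Ts ! i), Ts ! i) \<in> \<Theta>" if i: "i < length Ts" for i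
    proof -
      have "Ts ! i \<in> finite_nonempty_subsets A"
        using Ts(1) i by (auto intro: nth_mem)
      moreover have "as ! i \<in> closure (Ts ! i)"
        using list_all2_nthD2[OF as] i by simp
      ultimately show ?thesis
        using mem_closure_finite_iff by blast
    qed
    then have "list_all2 (\<lambda>S T. (S, T) \<in> \<Theta>) ?Ss Ts"
      using len by (simp add: list_all2_conv_all_nth)
    then have "(complex_op (op f) ?Ss, complex_op (op f) Ts) \<in> \<Theta>"
      using \<Theta> f Ts(2) len unfolding Con_fi_iff by simp
    moreover have "list_all2 (\<in>) as ?Ss"
      using len by (simp add: list_all2_conv_all_nth)
    then have "x \<in> complex_op (op f) ?Ss"
      unfolding complex_op_def x by blast
    ultimately show "x \<in> closure (complex_op (op f) Ts)"
      by (rule mem_if)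
  qed
  have endos: "\<phi> {r} \<subseteq> closure (\<phi> T)"
    if \<phi>: "\<phi> \<in> power_endomorphisms A \<Omega> ar op" and T: "T \<in> finite_nonempty_subsets A"
      and r: "r \<in> closure T" for \<phi> T r
  proof -
    have rT: "(insert r T, T) \<in> \<Theta>"
      using r mem_closure_finite_iff[OF T] by blast
    then have "r \<in> A"
      using cong_mem(1) unfolding finite_nonempty_subsets_def by blast
    then have "\<phi> ({r} \<union> T) = \<phi> {r} \<union> \<phi> T"
      by (intro power_endomorphisms_Un[OF \<phi> _ T] singleton_mem_finite_nonempty_subsets)
    moreover have "\<forall>(S, T)\<in>\<Theta>. (\<phi> S, \<phi> T) \<in> \<Theta>"
      using \<Theta> \<phi> unfolding Con_fi_iff by blast
    then have "(\<phi> (insert r T), \<phi> T) \<in> \<Theta>"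
      using rT by blast
    ultimately have "(\<phi> {r} \<union> \<phi> T, \<phi> T) \<in> \<Theta>"
      by simp
    then show ?thesis
      using mem_if by blast
  qed
  have algebraic: "algebraic_on A closure"
    unfolding algebraic_on_def using closure_eq_UN_finite by blast
  \<comment> \<open>Witnesses are nonempty, and the empty set has no nonempty subset.\<close>
  have empty: "closure {} = {}"
    using mem_closure_iff[of "{}"] unfolding finite_nonempty_subsets_def by blast
  show ?thesis
    unfolding Clo_fi_iff
    by (intro conjI ballI impI)
      (fact closure_operator_on_closure algebraic empty | rule ops endos; assumption)+
qed

section \<open>From closure operators to fully invariant congruences\<close>

lemma congruence_of_closure_in_Con_fi:
  assumes alg: "universal_algebra A \<Omega> ar op" and C: "C \<in> Clo_fi A \<Omega> ar op"
  shows "congruence_of_closure A C \<in> Con_fi A \<Omega> ar op"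
proof -
  interpret closure_operator A C
    using C unfolding Clo_fi_iff by unfold_locales blast
  let ?\<Theta> = "congruence_of_closure A C" and ?P = "finite_nonempty_subsets A"
  have carrier: "T \<subseteq> A" if "T \<in> ?P" for T
    using that unfolding finite_nonempty_subsets_def by blast
  have \<Theta>_sym: "(T, S) \<in> ?\<Theta>" if "(S, T) \<in> ?\<Theta>" for S T
    using that unfolding congruence_of_closure_def by simp
  \<comment> \<open>With equality of closures split into two inclusions, each compatibility below is
    proved in one direction and the other follows by symmetry.\<close>
  have \<Theta>_iff: "(S, T) \<in> ?\<Theta> \<longleftrightarrow> S \<in> ?P \<and> T \<in> ?P \<and> S \<subseteq> C T \<and> T \<subseteq> C S" for S T
    unfolding congruence_of_closure_def
    using closure_subset_iff[OF carrier carrier, of S T] closure_subset_iff[OF carrier carrier, of T S]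
    by blast
  have "equiv ?P ?\<Theta>"
    unfolding congruence_of_closure_def
    by (intro equivI refl_onI symI transI) auto
  moreover have "(complex_op (op f) Ss, complex_op (op f) Ts) \<in> ?\<Theta>"
    if f: "f \<in> \<Omega>" and Ss: "length Ss = ar f" "list_all2 (\<lambda>S T. (S, T) \<in> ?\<Theta>) Ss Ts" for f Ss Ts
  proof -
    have *: "complex_op (op f) Ss \<subseteq> C (complex_op (op f) Ts)"
        "Ts \<in> lists ?P" "length Ts = ar f"
      if Ss: "length Ss = ar f" "list_all2 (\<lambda>S T. (S, T) \<in> ?\<Theta>) Ss Ts" for Ss Ts
    proof -
      show len: "length Ts = ar f" and Ts: "Ts \<in> lists ?P"
        using Ss \<Theta>_iff by (auto simp: list_all2_conv_all_nth in_set_conv_nth)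
      have op_mem: "complex_op (op f) Ts \<in> ?P"
        using complex_op_mem_finite_nonempty_subsets[OF alg f Ts len] .
      have "list_all2 (\<subseteq>) Ss (map C Ts)"
        using Ss(2) \<Theta>_iff by (simp add: list_all2_conv_all_nth)
      then have sub: "complex_op (op f) Ss \<subseteq> complex_op (op f) (map C Ts)"
        by (rule complex_op_mono)
      show "complex_op (op f) Ss \<subseteq> C (complex_op (op f) Ts)"
      proof (cases "ar f = 0")
        \<comment> \<open>The condition in \<open>Clo_fi\<close> covers positive arities only. For a
          constant both argument lists are empty, so the two complex values coincide.\<close>
        case True
        then show ?thesis
          using Ss(1) len subset_closure[OF carrier[OF op_mem]] by simp
      next
        case False
        then show ?thesis
          using C f Ts len sub unfolding Clo_fi_iff by blast
      qed
    qed
    have "length Ts = ar f" "list_all2 (\<lambda>S T. (S, T) \<in> ?\<Theta>) Ts Ss"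
      using Ss \<Theta>_sym by (auto simp: list_all2_conv_all_nth)
    from *[OF Ss] *[OF this] show ?thesis
      using \<Theta>_iff complex_op_mem_finite_nonempty_subsets[OF alg f] by blast
  qed
  moreover have "(S \<union> T, S' \<union> T') \<in> ?\<Theta>" if "(S, S') \<in> ?\<Theta>" "(T, T') \<in> ?\<Theta>" for S S' T T'
  proof -
    have *: "S \<union> T \<subseteq> C (S' \<union> T')" "S' \<union> T' \<in> ?P"
      if "(S, S') \<in> ?\<Theta>" "(T, T') \<in> ?\<Theta>" for S S' T T'
    proof -
      show P: "S' \<union> T' \<in> ?P"
        using that \<Theta>_iff finite_nonempty_subsets_Un by blast
      have "C S' \<subseteq> C (S' \<union> T')" "C T' \<subseteq> C (S' \<union> T')"
        using carrier[OF P] subset_closure[OF carrier[OF P]]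
        by (subst closure_subset_iff; blast)+
      then show "S \<union> T \<subseteq> C (S' \<union> T')"
        using that \<Theta>_iff by blast
    qed
    from *[OF that] *[OF that[THEN \<Theta>_sym]] show ?thesis
      using \<Theta>_iff by blast
  qed
  moreover have "(\<phi> S, \<phi> T) \<in> ?\<Theta>"
    if \<phi>: "\<phi> \<in> power_endomorphisms A \<Omega> ar op" and ST: "(S, T) \<in> ?\<Theta>" for \<phi> S T
  proof -
    \<comment> \<open>Invariance applies to each \<open>s \<in> S\<close>, as
      \<open>s \<in> C T\<close>; the sets \<open>\<phi> {s}\<close> together make up
      \<open>\<phi> S\<close>.\<close>
    have "\<phi> S \<subseteq> C (\<phi> T)" if "(S, T) \<in> ?\<Theta>" for S T
    proof -
      have S: "S \<in> ?P" and T: "T \<in> ?P" and "S \<subseteq> C T"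
        using that \<Theta>_iff by blast+
      then have "\<phi> {s} \<subseteq> C (\<phi> T)" if "s \<in> S" for s
        using C \<phi> that unfolding Clo_fi_iff by blast
      then show ?thesis
        using power_endomorphisms_UN_singletons[OF \<phi> S] by blast
    qed
    then show ?thesis
      using ST \<Theta>_sym \<Theta>_iff power_endomorphisms_mem[OF \<phi>] by simp
  qed
  ultimately show ?thesis
    unfolding Con_fi_iff by blast
qed

section \<open>The two maps are mutually inverse\<close>

text \<open>On finite nonempty \<open>T\<close> the congruence of \<open>insert a T\<close> and
  \<open>T\<close> amounts to \<open>a \<in> C T\<close>. The operator built from the congruence
  thus sends \<open>B\<close> to the union of these \<open>C T\<close> over \<open>T\<close> in
  \<open>B\<close>, which is \<open>C B\<close> by algebraicity.\<close>

lemma closure_of_congruence_of_closure: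
  assumes C: "closure_operator_on A C" "algebraic_on A C"
  shows "closure_of_congruence A (congruence_of_closure A C) = C"
proof
  interpret closure_operator A C
    using C(1) by unfold_locales
  fix B
  show "closure_of_congruence A (congruence_of_closure A C) B = C B"
  proof (cases "B \<subseteq> A")
    case True
    have "(insert a T, T) \<in> congruence_of_closure A C \<longleftrightarrow> a \<in> C T"
      if "a \<in> A" and "T \<in> finite_nonempty_subsets B" for a T
    proof -
      have T: "T \<in> finite_nonempty_subsets A"
        using that finite_nonempty_subsets_mono[OF True] by blast
      then have "T \<subseteq> A"
        unfolding finite_nonempty_subsets_def by blast
      then show ?thesis
        using closure_insert_eq_iff[OF \<open>a \<in> A\<close>] finite_nonempty_subsets_insert[OF \<open>a \<in> A\<close> T] T
        unfolding congruence_of_closure_def by simp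
    qed
    then have "closure_of_congruence A (congruence_of_closure A C) B =
        A \<inter> \<Union> (C ` finite_nonempty_subsets B)"
      using True unfolding closure_of_congruence_def by auto
    also have "\<Union> (C ` finite_nonempty_subsets B) = C B"
      using C(2) True unfolding algebraic_on_def by blast
    finally show ?thesis
      using closure_subset_carrier[OF True] by blast
  next
    case False
    \<comment> \<open>Off \<open>Pow A\<close> both operators take the default value, so they agree
      as functions.\<close>
    then have "C B = undefined"
      using C(1) unfolding closure_operator_on_def by (auto dest: PiE_arb)
    with False show ?thesis
      unfolding closure_of_congruence_def by simp
  qed
qed

theorem theorem3p12:
  fixes A :: "'a set" and \<Omega> :: "'f set" and ar :: "'f \<Rightarrow> nat" and op :: "'f \<Rightarrow> 'a list \<Rightarrow> 'a"
  assumes "universal_algebra A \<Omega> ar op"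
  shows "\<exists>h. bij_betw h (Con_fi A \<Omega> ar op) (Clo_fi A \<Omega> ar op)"
proof
  show "bij_betw (closure_of_congruence A) (Con_fi A \<Omega> ar op) (Clo_fi A \<Omega> ar op)"
  proof (rule bij_betw_byWitness[where f' = "congruence_of_closure A"])
    show "\<forall>\<Theta>\<in>Con_fi A \<Omega> ar op. congruence_of_closure A (closure_of_congruence A \<Theta>) = \<Theta>"
    proof
      fix \<Theta> assume "\<Theta> \<in> Con_fi A \<Omega> ar op"
      then interpret semilattice_congruence A \<Theta>
        unfolding Con_fi_iff by unfold_locales blast+
      show "congruence_of_closure A (closure_of_congruence A \<Theta>) = \<Theta>"
        by (fact congruence_of_closure_closure)
    qed
    show "\<forall>C\<in>Clo_fi A \<Omega> ar op. closure_of_congruence A (congruence_of_closure A C) = C"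
      using closure_of_congruence_of_closure Clo_fi_iff by blast
    show "closure_of_congruence A ` Con_fi A \<Omega> ar op \<subseteq> Clo_fi A \<Omega> ar op"
      using closure_of_congruence_in_Clo_fi by blast
    show "congruence_of_closure A ` Clo_fi A \<Omega> ar op \<subseteq> Con_fi A \<Omega> ar op"
      using congruence_of_closure_in_Con_fi[OF assms] by blast
  qed
qed

end
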